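(* Let $\mathcal{D}_{n_0,d}$ denote the set of $2^{d-1}$ equivalents of the $d$-dimensional identity matrix $I_{n_0,d}$, and let $\mathcal{J}_{n_0,d}$ denote the set of all $d$-dimensional $n_0\times n_0\times\ldots\times n_0$ 0-1 matrices with exactly $n_0$ $1$-entries such that every pair of $1$-entries have the same coordinate in at least one dimension. For any family $\mathcal{P}$ of $d$-dimensional 0-1 matrices, if there exists a positive integer $n_0$ such that no element of $\mathcal{J}_{n_0,d}\cup\mathcal{D}_{n_0,d}$ avoids all patterns in $\mathcal{P}$, then $\operatorname{ex}(n,\mathcal{P},d)=O(1)$. Otherwise $\operatorname{ex}(n,\mathcal{P},d)\geq n$ (for every positive integer $n$).
   Context: A $d$-dimensional 0-1 matrix $A$ contains a $d$-dimensional 0-1 matrix $P$ if $A$ has a submatrix (obtained by restricting each of the $d$ coordinates to a subset of its range) of the same dimensions as $P$ that can be turned into $P$ by changing any number of $1$-entries to $0$-entries; otherwise $A$ avoids $P$. For a family $\mathcal{P}$ of $d$-dimensional 0-1 matrices, $\operatorname{ex}(n,\mathcal{P},d)$ is the maximum possible number of $1$-entries in a $d$-dimensional $n\times\dots\times n$ 0-1 matrix that avoids every element of $\mathcal{P}$ (taken to be $0$ if no such matrix exists). The $d$-dimensional identity matrix $I_{n_0,d}$ is the $n_0\times\dots\times n_0$ 0-1 matrix in which an entry is $1$ if and only if all of its $d$ coordinates are equal. An equivalent of $I_{n_0,d}$ is an $n_0\times\dots\times n_0$ permutation matrix (exactly $n_0$ $1$-entries, any two of which differ in every coordinate) such that,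 when its $1$-entries are ordered by their first coordinates, for every integer $i\in\{2,\dots,d\}$ their $i$-th coordinates are either increasing or decreasing. $O(1)$ means bounded as a function of $n$, for fixed $\mathcal{P}$ and $d$. *)

theory Defs
  imports Main
begin

text \<open>
  A 0-1 matrix is given by the list of its side lengths and the set of the positions of its
  1-entries.  Positions are lists of coordinates, and coordinates are counted from 0: those in
  dimension \<open>i\<close> range over \<open>{0..<dims A ! i}\<close>.
\<close>

record mat01 =
  dims :: "nat list"
  ones :: "nat list set"

definition positions :: "nat list \<Rightarrow> nat list set" where
  "positions ns = {x. length x = length ns \<and> (\<forall>i<length ns. x ! i < ns ! i)}"

definition is_mat :: "nat \<Rightarrow> mat01 \<Rightarrow> bool" where
  "is_mat d A \<longleftrightarrow>
     length (dims A) = d \<and> (\<forall>i<d. dims A ! i > 0) \<and> ones A \<subseteq> positions (dims A)"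

definition cube_mats :: "nat \<Rightarrow> nat \<Rightarrow> mat01 set" where
  "cube_mats n d = {A. is_mat d A \<and> dims A = replicate d n}"

text \<open>
  \<open>S ! i\<close> is the set of the coordinates of dimension \<open>i\<close> that are kept; coordinate \<open>k\<close> of the
  submatrix stands for the \<open>k\<close>-th smallest element of \<open>S ! i\<close>.
\<close>

definition submat :: "mat01 \<Rightarrow> nat set list \<Rightarrow> mat01" where
  "submat A S =
     \<lparr>dims = map card S,
      ones = {x \<in> positions (map card S). map2 (\<lambda>T k. sorted_list_of_set T ! k) S x \<in> ones A}\<rparr>"

definition contains :: "mat01 \<Rightarrow> mat01 \<Rightarrow> bool" where
  "contains A P \<longleftrightarrow>
     (\<exists>S. length S = length (dims A) \<and> (\<forall>i<length S. S ! i \<subseteq> {0..<dims A ! i}) \<and>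
          dims (submat A S) = dims P \<and> ones P \<subseteq> ones (submat A S))"

abbreviation avoids :: "mat01 \<Rightarrow> mat01 \<Rightarrow> bool" where
  "avoids A P \<equiv> \<not> contains A P"

definition ex_num :: "nat \<Rightarrow> mat01 set \<Rightarrow> nat \<Rightarrow> nat" where
  "ex_num n \<P> d =
     (let \<A> = {A \<in> cube_mats n d. \<forall>P\<in>\<P>. avoids A P}
      in if \<A> = {} then 0 else Max ((\<lambda>A. card (ones A)) ` \<A>))"

definition id_mat :: "nat \<Rightarrow> nat \<Rightarrow> mat01" where
  "id_mat n d =
     \<lparr>dims = replicate d n,
      ones = {x \<in> positions (replicate d n). \<forall>i<d. \<forall>j<d. x ! i = x ! j}\<rparr>"

definition perm_mats :: "nat \<Rightarrow> nat \<Rightarrow> mat01 set" where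
  "perm_mats n d =
     {A \<in> cube_mats n d. card (ones A) = n \<and>
        (\<forall>x\<in>ones A. \<forall>y\<in>ones A. x \<noteq> y \<longrightarrow> (\<forall>i<d. x ! i \<noteq> y ! i))}"

text \<open>The set of the equivalents of \<^term>\<open>id_mat n d\<close>.\<close>

definition D_mats :: "nat \<Rightarrow> nat \<Rightarrow> mat01 set" where
  "D_mats n d =
     {A \<in> perm_mats n d. \<forall>i\<in>{1..<d}.
        (\<forall>x\<in>ones A. \<forall>y\<in>ones A. x ! 0 < y ! 0 \<longrightarrow> x ! i < y ! i) \<or>
        (\<forall>x\<in>ones A. \<forall>y\<in>ones A. x ! 0 < y ! 0 \<longrightarrow> x ! i > y ! i)}"

definition J_mats :: "nat \<Rightarrow> nat \<Rightarrow> mat01 set" where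
  "J_mats n d =
     {A \<in> cube_mats n d. card (ones A) = n \<and>
        (\<forall>x\<in>ones A. \<forall>y\<in>ones A. x \<noteq> y \<longrightarrow> (\<exists>i<d. x ! i = y ! i))}"

lemma id_mat_in_D_mats:
  assumes "n > 0" "d > 0"
  shows "id_mat n d \<in> D_mats n d"
proof -
  have *: "ones (id_mat n d) = (\<lambda>k. replicate d k) ` {0..<n}"
  proof (rule set_eqI, rule iffI)
    fix x assume x: "x \<in> ones (id_mat n d)"
    have pos: "x \<in> positions (replicate d n)"
      using x unfolding id_mat_def by simp
    have "\<forall>i<d. \<forall>j<d. x ! i = x ! j"
      using x unfolding id_mat_def mat01.select_convs by blast
    then have eq: "x ! i = x ! 0" if "i < d" for i
      using that assms(2) by blast
    have len: "length x = d" and lt: "x ! 0 < n"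
      using pos assms(2) by (simp_all add: positions_def)
    have "x = replicate d (x ! 0)"
    proof (rule nth_equalityI)
      show "length x = length (replicate d (x ! 0))"
        using len by simp
    next
      fix i assume "i < length x"
      then have i: "i < d" by (simp only: len)
      show "x ! i = replicate d (x ! 0) ! i"
        by (simp only: nth_replicate[OF i] eq[OF i])
    qed
    then show "x \<in> (\<lambda>k. replicate d k) ` {0..<n}"
      using lt by (intro image_eqI[of x _ "x ! 0"]) simp_all
  next
    fix x assume "x \<in> (\<lambda>k. replicate d k) ` {0..<n}"
    then obtain k where k: "x = replicate d k" "k < n"
      using assms(2) by auto
    show "x \<in> ones (id_mat n d)"
      unfolding k(1) using k(2) by (simp add: id_mat_def positions_def)
  qed
  have "inj_on (\<lambda>k. replicate d k) {0..<n}"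
    using assms by (auto simp: inj_on_def replicate_eq_replicate)
  then have "card (ones (id_mat n d)) = n"
    by (simp add: * card_image)
  moreover have "id_mat n d \<in> cube_mats n d"
    using assms by (auto simp: cube_mats_def is_mat_def id_mat_def)
  ultimately show ?thesis
    using assms by (auto simp: D_mats_def perm_mats_def *)
qed

end

theory Submission
  imports Defs "HOL-Library.Ramsey"
begin

text \<open>
  By Ramsey's theorem, sufficiently many 1-entries include \<open>n0\<close> of them any two of which compare
  in the same way in every dimension: equal coordinates, or the same or the opposite
  order as in dimension 0.  If some dimension is of the first kind, restricting the matrix to
  \<open>n0\<close> coordinates in each dimension yields an element of \<^term>\<open>J_mats n0 d\<close>, and otherwise one
  of \<^term>\<open>D_mats n0 d\<close>.  For the lower bound, an avoiding element of either set has \<open>n\<close> ones.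
\<close>

section \<open>Counting cube matrices and bounding \<open>ex_num\<close>\<close>

lemma finite_positions: "finite (positions (replicate d n))"
  and card_positions: "card (positions (replicate d n)) = n ^ d"
proof -
  have "positions (replicate d n) = {x. set x \<subseteq> {..<n} \<and> length x = d}"
    by (auto simp: positions_def in_set_conv_nth subset_iff)
  then show "finite (positions (replicate d n))" "card (positions (replicate d n)) = n ^ d"
    by (simp_all add: finite_lists_length_eq card_lists_length_eq)
qed

lemma cube_mats_finite_ones:
  assumes "A \<in> cube_mats n d"
  shows "finite (ones A)" "card (ones A) \<le> n ^ d"
proof -
  have sub: "ones A \<subseteq> positions (replicate d n)"
    using assms by (auto simp: cube_mats_def is_mat_def)
  then show "finite (ones A)"
    using finite_positions finite_subset by blast
  show "card (ones A) \<le> n ^ d"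
    using card_mono[OF finite_positions sub] by (simp add: card_positions)
qed

lemma finite_cube_mats: "finite (cube_mats n d)"
proof (rule finite_subset)
  show "cube_mats n d \<subseteq> (\<lambda>X. \<lparr>dims = replicate d n, ones = X\<rparr>) ` Pow (positions (replicate d n))"
    by (auto simp: cube_mats_def is_mat_def intro!: image_eqI[of _ _ "ones _"])
  show "finite ((\<lambda>X. \<lparr>dims = replicate d n, ones = X\<rparr>) ` Pow (positions (replicate d n)))"
    by (simp add: finite_positions)
qed

lemma card_ones_le_ex_num:
  assumes "A \<in> cube_mats n d" "\<forall>P\<in>\<P>. avoids A P"
  shows "card (ones A) \<le> ex_num n \<P> d"
proof -
  have "finite ((\<lambda>A. card (ones A)) ` {A \<in> cube_mats n d. \<forall>P\<in>\<P>. avoids A P})"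
    using finite_cube_mats by auto
  then show ?thesis
    using assms unfolding ex_num_def Let_def by auto
qed

text \<open>When no avoiding matrix exists, \<open>ex_num\<close> takes its default value 0 and the
  bound is trivial; otherwise the maximum is over a finite nonempty set.\<close>

lemma ex_num_le:
  assumes "\<And>A. A \<in> cube_mats n d \<Longrightarrow> \<forall>P\<in>\<P>. avoids A P \<Longrightarrow> card (ones A) \<le> C"
  shows "ex_num n \<P> d \<le> C"
  using assms finite_cube_mats by (auto simp: ex_num_def Let_def)

section \<open>Containment as strictly increasing coordinate maps\<close>

definition embed :: "(nat \<Rightarrow> nat \<Rightarrow> nat) \<Rightarrow> nat list \<Rightarrow> nat list" where
  "embed f x = map2 f [0..<length x] x"

lemma length_embed [simp]: "length (embed f x) = length x"
  by (simp add: embed_def)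

lemma nth_embed [simp]: "i < length x \<Longrightarrow> embed f x ! i = f i (x ! i)"
  by (simp add: embed_def)

text \<open>Containment stated with one increasing map per dimension in place of one set of kept
  coordinates. Such maps compose directly, which makes transitivity of \<open>contains\<close>
  immediate.\<close>

definition mat_embedding :: "(nat \<Rightarrow> nat \<Rightarrow> nat) \<Rightarrow> mat01 \<Rightarrow> mat01 \<Rightarrow> bool" where
  "mat_embedding f P A \<longleftrightarrow>
     length (dims P) = length (dims A) \<and>
     (\<forall>i<length (dims A). strict_mono_on {..<dims P ! i} (f i) \<and>
        f i ` {..<dims P ! i} \<subseteq> {..<dims A ! i}) \<and>
     embed f ` ones P \<subseteq> ones A"

lemma mat_embedding_compose:
  assumes f: "mat_embedding f P B" and g: "mat_embedding g B A"
  shows "mat_embedding (\<lambda>i. g i \<circ> f i) P A"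
proof -
  have "embed (\<lambda>i. g i \<circ> f i) x = embed g (embed f x)" for x
    by (rule nth_equalityI) simp_all
  moreover have "strict_mono_on {..<dims P ! i} (g i \<circ> f i)" if "i < length (dims A)" for i
    using assms that unfolding mat_embedding_def
    by (auto intro!: strict_mono_onI dest!: spec[of _ i] simp: image_subset_iff strict_mono_onD)
  ultimately show ?thesis
    using assms unfolding mat_embedding_def by (auto simp: image_subset_iff)
qed

lemma nth_sorted_list_of_set_strict_mono:
  "strict_mono_on {..<card T} ((!) (sorted_list_of_set (T :: 'a::linorder set)))"
  by (auto intro!: strict_mono_onI sorted_wrt_nth_less[of "(<)"])

lemma nth_sorted_list_of_set_image:
  assumes "finite (T :: 'a::linorder set)"
  shows "(!) (sorted_list_of_set T) ` {..<card T} = T"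
  using assms nth_image[of "card T" "sorted_list_of_set T"]
  by (simp add: atLeast0LessThan)

lemma sorted_list_of_set_image_strict_mono:
  assumes "strict_mono_on {..<n} (f :: nat \<Rightarrow> 'a::linorder)"
  shows "sorted_list_of_set (f ` {..<n}) = map f [0..<n]"
proof (rule strict_sorted_equal)
  show "sorted_wrt (<) (map f [0..<n])"
    using assms by (auto simp: sorted_wrt_iff_nth_less intro: strict_mono_onD)
qed (auto simp: atLeast0LessThan)

text \<open>A finite set of naturals and its increasing enumeration determine each other. The
  hypothesis keeps every coordinate of a 1-entry in the range where \<open>f i\<close> agrees with
  the sorted list of its image.\<close>

lemma contains_iff_embedding:
  assumes "ones P \<subseteq> positions (dims P)"
  shows "contains A P \<longleftrightarrow> (\<exists>f. mat_embedding f P A)"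
proof
  assume "contains A P"
  then obtain S where len: "length S = length (dims A)"
    and S: "\<And>i. i < length S \<Longrightarrow> S ! i \<subseteq> {0..<dims A ! i}"
    and dims: "map card S = dims P" and ones: "ones P \<subseteq> ones (submat A S)"
    unfolding contains_def submat_def by auto
  define f where "f i = (!) (sorted_list_of_set (S ! i))" for i
  have card: "dims P ! i = card (S ! i)" if "i < length S" for i
    using that by (simp flip: dims)
  have "embed f x \<in> ones A" if "x \<in> ones P" for x
  proof -
    have "length x = length S"
      using that assms by (auto simp: positions_def simp flip: dims)
    then have "embed f x = map2 (\<lambda>T k. sorted_list_of_set T ! k) S x"
      by (intro nth_equalityI) (simp_all add: f_def)
    then show ?thesis
      using that ones by (auto simp: submat_def)
  qed
  moreover have "f i ` {..<dims P ! i} \<subseteq> {..<dims A ! i}" if "i < length S" for i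
    using S[OF that] nth_sorted_list_of_set_image[of "S ! i"]
    by (auto simp: f_def card[OF that] lessThan_atLeast0 dest: finite_subset)
  ultimately have "mat_embedding f P A"
    using len dims[symmetric] nth_sorted_list_of_set_strict_mono
    by (auto simp: mat_embedding_def card f_def)
  then show "\<exists>f. mat_embedding f P A" by blast
next
  assume "\<exists>f. mat_embedding f P A"
  then obtain f where f: "mat_embedding f P A" ..
  \<comment> \<open>The kept coordinates are the values of the maps; by strict monotonicity, listing
    \<open>S ! i\<close> in order gives back \<open>f i\<close>.\<close>
  define S where "S = map (\<lambda>i. f i ` {..<dims P ! i}) [0..<length (dims A)]"
  have len: "length S = length (dims A)" "length (dims P) = length (dims A)"
    using f by (simp_all add: S_def mat_embedding_def)
  have mono: "strict_mono_on {..<dims P ! i} (f i)" if "i < length (dims A)" for i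
    using f that by (simp add: mat_embedding_def)
  have dims: "map card S = dims P"
    using len mono by (intro nth_equalityI) (simp_all add: S_def card_image strict_mono_on_imp_inj_on)
  have "x \<in> ones (submat A S)" if x: "x \<in> ones P" for x
  proof -
    have pos: "x \<in> positions (dims P)"
      using x assms by blast
    then have "map2 (\<lambda>T k. sorted_list_of_set T ! k) S x = embed f x"
      using len mono
      by (intro nth_equalityI)
        (simp_all add: S_def positions_def sorted_list_of_set_image_strict_mono)
    then show ?thesis
      using pos f x by (auto simp: submat_def dims mat_embedding_def)
  qed
  then show "contains A P"
    unfolding contains_def using len f dims
    by (intro exI[of _ S])
      (auto simp: S_def submat_def mat_embedding_def atLeast0LessThan image_subset_iff)
qed

lemma contains_trans:
  assumes "contains A B" "contains B P"
    and "ones B \<subseteq> positions (dims B)" "ones P \<subseteq> positions (dims P)"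
  shows "contains A P"
  using assms contains_iff_embedding mat_embedding_compose by metis

section \<open>Ramsey's theorem for pairs with an arbitrary finite set of colours\<close>

text \<open>Transfers \<open>ramsey_full\<close>, which colours subsets of an initial segment of the
  naturals with numbers, by encoding colours through \<open>h\<close> and enumerating
  \<open>X\<close> through \<open>g\<close>. The bound \<open>N\<close> is chosen before
  \<open>X\<close> and \<open>c\<close>, so it is uniform in both.\<close>

lemma ramsey_pairs:
  assumes "finite B"
  shows "\<exists>N. \<forall>(X :: 'a set) (c :: 'a set \<Rightarrow> 'b).
    finite X \<and> N \<le> card X \<and> c ` [X]\<^bsup>2\<^esup> \<subseteq> B \<longrightarrow> (\<exists>H\<in>[X]\<^bsup>m\<^esup>. \<exists>b. c ` [H]\<^bsup>2\<^esup> \<subseteq> {b})"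
proof -
  obtain N :: nat where N: "partn_lst {..<N} (replicate (card B) m) 2"
    using ramsey_full by blast
  obtain h where h: "bij_betw h B {..<card B}"
    using ex_bij_betw_finite_nat[OF assms] by (auto simp: atLeast0LessThan)
  show ?thesis
  proof (intro exI[of _ N] allI impI, elim conjE)
    fix X :: "'a set" and c :: "'a set \<Rightarrow> 'b"
    assume X: "finite X" "N \<le> card X" and c: "c ` [X]\<^bsup>2\<^esup> \<subseteq> B"
    obtain g where g: "bij_betw g {..<card X} X"
      using ex_bij_betw_nat_finite[OF X(1)] by (auto simp: atLeast0LessThan)
    \<comment> \<open>Only the first \<open>N\<close> elements in the enumeration of
      \<open>X\<close> are coloured.\<close>
    have inj: "inj_on g {..<N}" and im: "g ` {..<N} \<subseteq> X"
      using g X(2) by (auto simp: bij_betw_def intro: inj_on_subset)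
    have img: "g ` e \<in> [X]\<^bsup>k\<^esup>" if "e \<in> [{..<N}]\<^bsup>k\<^esup>" for e k
      using that inj im by (auto simp: nsets_def card_image inj_on_subset)
    have "(\<lambda>e. h (c (g ` e))) \<in> [{..<N}]\<^bsup>2\<^esup> \<rightarrow> {..<card B}"
      using img c bij_betwE[OF h] by (auto simp: image_subset_iff)
    then obtain i where i: "i < card B"
      and "monochromatic {..<N} (replicate (card B) m ! i) 2 (\<lambda>e. h (c (g ` e))) i"
      using N unfolding partn_lst_def by auto
    then obtain H where H: "H \<in> [{..<N}]\<^bsup>m\<^esup>" and mono: "(\<lambda>e. h (c (g ` e))) ` [H]\<^bsup>2\<^esup> \<subseteq> {i}"
      by (auto simp: monochromatic_def)
    have "c e = inv_into B h i" if e: "e \<in> [g ` H]\<^bsup>2\<^esup>" for e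
    proof -
      have sub: "H \<subseteq> {..<N}"
        using H by (simp add: nsets_def)
      obtain e' where e': "e' \<subseteq> H" "e = g ` e'"
        using e by (auto simp: nsets_def subset_image_iff)
      have "inj_on g e'"
        using inj e'(1) sub by (meson inj_on_subset subset_trans)
      then have "e' \<in> [H]\<^bsup>2\<^esup>"
        using e e' by (auto simp: nsets_def card_image finite_image_iff)
      then have "h (c e) = i"
        using mono e'(2) by auto
      moreover have "c e \<in> B"
        using e img[OF H] c by (auto simp: nsets_def)
      ultimately show ?thesis
        using h by (auto simp: bij_betw_def)
    qed
    then show "\<exists>H\<in>[X]\<^bsup>m\<^esup>. \<exists>b. c ` [H]\<^bsup>2\<^esup> \<subseteq> {b}"
      using img[OF H] by blast
  qed
qed

section \<open>From homogeneous sets of 1-entries to members of \<open>J_mats\<close> and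
  \<open>D_mats\<close>\<close>

text \<open>The \<open>m\<close> entries of \<open>X\<close> use at most \<open>m\<close>
  coordinates in each dimension. As \<open>m \<le> n\<close>, these extend to exactly
  \<open>m\<close> coordinates, so the submatrix is a cube of side \<open>m\<close>; its 1-entries
  outside \<open>X\<close> are changed to 0.\<close>

lemma cube_compress:
  assumes A: "A \<in> cube_mats n d" and X: "X \<subseteq> ones A" "card X = m" and m: "0 < m" "m \<le> n"
  obtains B f where "B \<in> cube_mats m d" "contains A B" "bij_betw (embed f) (ones B) X"
    "\<And>i. i < d \<Longrightarrow> strict_mono_on {..<m} (f i)"
proof -
  have pos: "ones A \<subseteq> positions (replicate d n)" and dimA: "dims A = replicate d n"
    using A by (auto simp: cube_mats_def is_mat_def)
  \<comment> \<open>An infinite set has \<open>card\<close> 0, so \<open>0 < m\<close> forces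
    finiteness.\<close>
  have fin: "finite X"
    using X m card.infinite by fastforce
  have "\<exists>T. (\<lambda>x. x ! i) ` X \<subseteq> T \<and> T \<subseteq> {..<n} \<and> card T = m" if "i < d" for i
    using that pos X m card_image_le[OF fin, of "\<lambda>x. x ! i"]
    by (intro exists_subset_between) (auto simp: positions_def)
  then obtain T where T: "\<And>i. i < d \<Longrightarrow> (\<lambda>x. x ! i) ` X \<subseteq> T i"
      "\<And>i. i < d \<Longrightarrow> T i \<subseteq> {..<n}" "\<And>i. i < d \<Longrightarrow> card (T i) = m"
    by metis
  define f where "f i = (!) (sorted_list_of_set (T i))" for i
  have mono: "strict_mono_on {..<m} (f i)" if "i < d" for i
    using nth_sorted_list_of_set_strict_mono[of "T i"] T(3)[OF that] by (simp add: f_def)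
  have im: "f i ` {..<m} = T i" if "i < d" for i
    using nth_sorted_list_of_set_image[of "T i"] T[OF that] by (auto simp: f_def dest: finite_subset)
  define B where "B = \<lparr>dims = replicate d m, ones = {y \<in> positions (replicate d m). embed f y \<in> X}\<rparr>"
  have B: "B \<in> cube_mats m d"
    using m by (auto simp: B_def cube_mats_def is_mat_def)
  have "mat_embedding f B A"
    using mono im T X by (auto simp: mat_embedding_def B_def dimA)
  then have "contains A B"
    by (subst contains_iff_embedding) (auto simp: B_def)
  moreover have "bij_betw (embed f) (ones B) X"
    unfolding bij_betw_def
  proof
    show "inj_on (embed f) (ones B)"
    proof (rule inj_onI)
      fix x y assume xy: "x \<in> ones B" "y \<in> ones B" "embed f x = embed f y"
      then have *: "length x = d" "length y = d" "\<And>i. i < d \<Longrightarrow> x ! i < m \<and> y ! i < m"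
        by (auto simp: B_def positions_def)
      show "x = y"
      proof (rule nth_equalityI)
        fix i assume "i < length x"
        then have i: "i < d" using * by simp
        have "f i (x ! i) = f i (y ! i)"
          using arg_cong[OF xy(3), of "\<lambda>z. z ! i"] * i by simp
        then show "x ! i = y ! i"
          using strict_mono_on_eq[OF mono[OF i]] *(3)[OF i] by simp
      qed (use * in simp)
    qed
    \<comment> \<open>A preimage is built coordinatewise, since \<open>x ! i\<close> lies in
      \<open>T i\<close>, the range of \<open>f i\<close>.\<close>
    have "x \<in> embed f ` ones B" if x: "x \<in> X" for x
    proof -
      have len: "length x = d"
        using x X pos by (auto simp: positions_def)
      have "\<exists>k<m. f i k = x ! i" if "i < d" for i
        proof -
        have "x ! i \<in> f i ` {..<m}"
          using T(1)[OF that] im[OF that] x by auto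
        then show ?thesis by auto
      qed
      then obtain k where k: "\<And>i. i < d \<Longrightarrow> k i < m \<and> f i (k i) = x ! i"
        by metis
      have "embed f (map k [0..<d]) = x"
        using len k by (intro nth_equalityI) simp_all
      moreover from this have "map k [0..<d] \<in> ones B"
        using k x by (auto simp: B_def positions_def)
      ultimately show ?thesis by (metis image_eqI)
    qed
    then show "embed f ` ones B = X"
      by (auto simp: B_def)
  qed
  ultimately show thesis
    using that B mono by blast
qed

text \<open>\<open>E\<close> collects the dimensions in which distinct entries agree,
  \<open>L\<close> those ordered like dimension 0. Strictly increasing maps preserve and reflect
  both comparisons, so the compressed cube inherits the pattern.\<close>

lemma ones_pairs_homogeneous:
  assumes "\<And>x y. x \<in> X \<Longrightarrow> y \<in> X \<Longrightarrow> x \<noteq> y \<Longrightarrow> {i. i < d \<and> x ! i = y ! i} = E"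
    and "\<And>x y. x \<in> X \<Longrightarrow> y \<in> X \<Longrightarrow> x ! 0 < y ! 0 \<Longrightarrow> {i. i < d \<and> x ! i < y ! i} = L"
    and A: "A \<in> cube_mats n d" and X: "X \<subseteq> ones A" "card X = m" and m: "0 < m" "m \<le> n"
  obtains B where "B \<in> J_mats m d \<union> D_mats m d" "contains A B"
proof -
  obtain B f where B: "B \<in> cube_mats m d" "contains A B" and bij: "bij_betw (embed f) (ones B) X"
    and mono: "\<And>i. i < d \<Longrightarrow> strict_mono_on {..<m} (f i)"
    using cube_compress[OF A X m] by blast
  have "ones B \<subseteq> positions (replicate d m)"
    using B(1) by (auto simp: cube_mats_def is_mat_def)
  then have pos: "length x = d \<and> (\<forall>i<d. x ! i < m)" if "x \<in> ones B" for x
    using that by (auto simp: positions_def)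
  have less: "embed f x ! i < embed f y ! i \<longleftrightarrow> x ! i < y ! i"
    and eq: "embed f x ! i = embed f y ! i \<longleftrightarrow> x ! i = y ! i"
    if "x \<in> ones B" "y \<in> ones B" "i < d" for x y i
    using pos[OF that(1)] pos[OF that(2)] that(3)
      strict_mono_on_less[OF mono[OF that(3)], of "x ! i" "y ! i"]
      strict_mono_on_eq[OF mono[OF that(3)], of "x ! i" "y ! i"]
    by auto
  have mem: "embed f x \<in> X" if "x \<in> ones B" for x
    using bij that by (auto simp: bij_betw_def)
  have neq: "embed f x \<noteq> embed f y" if "x \<in> ones B" "y \<in> ones B" "x \<noteq> y" for x y
    using bij that by (auto simp: bij_betw_def inj_on_def)
  have card: "card (ones B) = m"
    using bij_betw_same_card[OF bij] X by simp
  have E: "x ! i = y ! i \<longleftrightarrow> i \<in> E"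
    if xy: "x \<in> ones B" "y \<in> ones B" "x \<noteq> y" and i: "i < d" for x y i
    using assms(1)[OF mem[OF xy(1)] mem[OF xy(2)] neq[OF xy]] eq[OF xy(1,2) i] i by auto
  have L: "x ! i < y ! i \<longleftrightarrow> i \<in> L"
    if xy: "x \<in> ones B" "y \<in> ones B" "x ! 0 < y ! 0" and i: "i < d" for x y i
  proof -
    \<comment> \<open>The assumption \<open>i < d\<close> also ensures that dimension 0
      exists.\<close>
    have "embed f x ! 0 < embed f y ! 0"
      using less[OF xy(1,2), of 0] xy(3) i by simp
    from assms(2)[OF mem[OF xy(1)] mem[OF xy(2)] this] less[OF xy(1,2) i] i
    show ?thesis by auto
  qed
  \<comment> \<open>A single dimension in \<open>E\<close> serves all pairs at once.\<close>
  have "B \<in> J_mats m d" if "\<exists>i<d. i \<in> E"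
    using that E B(1) card by (auto simp: J_mats_def)
  moreover have "B \<in> D_mats m d" if none: "\<forall>i<d. i \<notin> E"
  proof -
    have "B \<in> perm_mats m d"
      using none E B(1) card by (auto simp: perm_mats_def)
    moreover have "(\<forall>x\<in>ones B. \<forall>y\<in>ones B. x ! 0 < y ! 0 \<longrightarrow> x ! i < y ! i) \<or>
        (\<forall>x\<in>ones B. \<forall>y\<in>ones B. x ! 0 < y ! 0 \<longrightarrow> x ! i > y ! i)" if i: "i < d" for i
    proof (cases "i \<in> L")
      case False
      \<comment> \<open>Outside \<open>E\<close> there are no ties, so a dimension outside
        \<open>L\<close> must be decreasing.\<close>
      have "y ! i < x ! i" if xy: "x \<in> ones B" "y \<in> ones B" "x ! 0 < y ! 0" for x y
      proof -
        have "x \<noteq> y" using xy(3) by auto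
        then show ?thesis
          using L[OF xy i] E[OF xy(1,2) _ i] none i False by auto
      qed
      then show ?thesis by blast
    qed (use L i in blast)
    ultimately show ?thesis
      by (auto simp: D_mats_def)
  qed
  ultimately show thesis
    using that B(2) by blast
qed

text \<open>The bound comes from Ramsey's theorem with a number of colours depending only on
  \<open>d\<close>, so \<open>C\<close> is independent of \<open>n\<close>.\<close>

lemma many_ones_contain_J_or_D:
  assumes "0 < m"
  obtains C where
    "\<And>A n. A \<in> cube_mats n d \<Longrightarrow> C < card (ones A) \<Longrightarrow> \<exists>B \<in> J_mats m d \<union> D_mats m d. contains A B"
proof -
  \<comment> \<open>A colour must depend on the unordered pair. The first component is symmetric;
    the second orients the pair by dimension 0 and is empty on a tie there.\<close>
  let ?c = "\<lambda>e :: nat list set.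
    ({i. i < d \<and> (\<exists>x\<in>e. \<exists>y\<in>e. x \<noteq> y \<and> x ! i = y ! i)},
     {i. i < d \<and> (\<exists>x\<in>e. \<exists>y\<in>e. x ! 0 < y ! 0 \<and> x ! i < y ! i)})"
  have "finite (Pow {..<d} \<times> Pow {..<d})"
    by simp
  from ramsey_pairs[OF this, of m]
  obtain N where N: "\<forall>(X :: nat list set) (c :: nat list set \<Rightarrow> nat set \<times> nat set).
      finite X \<and> N \<le> card X \<and> c ` [X]\<^bsup>2\<^esup> \<subseteq> Pow {..<d} \<times> Pow {..<d} \<longrightarrow>
      (\<exists>H\<in>[X]\<^bsup>m\<^esup>. \<exists>b. c ` [H]\<^bsup>2\<^esup> \<subseteq> {b})" ..
  \<comment> \<open>The summand \<open>N\<close> is for Ramsey's theorem. The summand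
    \<open>m ^ d\<close> forces \<open>m \<le> n\<close>, as a cube of side \<open>n\<close> has at
    most \<open>n ^ d\<close> ones.\<close>
  show thesis
  proof (rule that[of "N + m ^ d"])
    fix A n assume A: "A \<in> cube_mats n d" and large: "N + m ^ d < card (ones A)"
    have "m ^ d < n ^ d"
      using cube_mats_finite_ones(2)[OF A] large by simp
    then have mn: "m \<le> n"
      by (meson less_imp_le not_le power_mono zero_le)
    have "?c ` [ones A]\<^bsup>2\<^esup> \<subseteq> Pow {..<d} \<times> Pow {..<d}"
      by auto
    moreover have "finite (ones A)" "N \<le> card (ones A)"
      using cube_mats_finite_ones(1)[OF A] large by simp_all
    ultimately have "\<exists>H\<in>[ones A]\<^bsup>m\<^esup>. \<exists>b. ?c ` [H]\<^bsup>2\<^esup> \<subseteq> {b}"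
      using N by blast
    then obtain X b where X: "X \<in> [ones A]\<^bsup>m\<^esup>" and b: "?c ` [X]\<^bsup>2\<^esup> \<subseteq> {b}"
      by blast
    obtain E L where mono: "?c ` [X]\<^bsup>2\<^esup> \<subseteq> {(E, L)}"
      using b by (cases b) simp
    have color: "?c {x, y} = (E, L)" if "x \<in> X" "y \<in> X" "x \<noteq> y" for x y
    proof -
      have "{x, y} \<in> [X]\<^bsup>2\<^esup>"
        using that by (auto simp: nsets_2_eq)
      with mono show ?thesis by blast
    qed
    have E: "{i. i < d \<and> x ! i = y ! i} = E" if "x \<in> X" "y \<in> X" "x \<noteq> y" for x y
      using color[OF that] that(3) by auto
    \<comment> \<open>The condition on dimension 0 leaves \<open>(x, y)\<close> as the only
      orientation that can witness the second component.\<close>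
    have L: "{i. i < d \<and> x ! i < y ! i} = L" if "x \<in> X" "y \<in> X" "x ! 0 < y ! 0" for x y
    proof -
      have "x \<noteq> y" using that by auto
      from color[OF that(1,2) this] that(3) show ?thesis by auto
    qed
    have "X \<subseteq> ones A" "card X = m"
      using X by (auto simp: nsets_def)
    from ones_pairs_homogeneous[OF E L A this assms mn]
    show "\<exists>B \<in> J_mats m d \<union> D_mats m d. contains A B"
      by blast
  qed
qed

section \<open>The dichotomy between bounded and at least linear growth\<close>

theorem lemma3p23:
  fixes d :: nat and \<P> :: "mat01 set"
  assumes "d \<ge> 1"
    and "\<forall>P\<in>\<P>. is_mat d P"
  shows "((\<exists>n0>0. \<not> (\<exists>A \<in> J_mats n0 d \<union> D_mats n0 d. \<forall>P\<in>\<P>. avoids A P)) \<longrightarrow>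
            (\<exists>C::nat. \<forall>n>0. ex_num n \<P> d \<le> C)) \<and>
         (\<not> (\<exists>n0>0. \<not> (\<exists>A \<in> J_mats n0 d \<union> D_mats n0 d. \<forall>P\<in>\<P>. avoids A P)) \<longrightarrow>
            (\<forall>n>0. ex_num n \<P> d \<ge> n))"
proof (intro conjI impI allI)
  have cube: "A \<in> cube_mats m d" "card (ones A) = m" if "A \<in> J_mats m d \<union> D_mats m d" for A m
    using that by (auto simp: J_mats_def D_mats_def perm_mats_def)
  {
    assume "\<exists>n0>0. \<not> (\<exists>A \<in> J_mats n0 d \<union> D_mats n0 d. \<forall>P\<in>\<P>. avoids A P)"
    then obtain m where m: "0 < m"
      and hit: "\<And>B. B \<in> J_mats m d \<union> D_mats m d \<Longrightarrow> \<exists>P\<in>\<P>. contains B P"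
      by blast
    obtain C where C: "\<And>A n. A \<in> cube_mats n d \<Longrightarrow> C < card (ones A) \<Longrightarrow>
        \<exists>B \<in> J_mats m d \<union> D_mats m d. contains A B"
      using many_ones_contain_J_or_D[OF m] by blast
    \<comment> \<open>With more than \<open>C\<close> ones, \<open>A\<close> would contain some
      \<open>B\<close> in \<open>J_mats\<close> or \<open>D_mats\<close> of side \<open>m\<close>;
      by the choice of \<open>m\<close>, \<open>B\<close> contains a forbidden pattern, and so would
      \<open>A\<close> by transitivity.\<close>
    have "card (ones A) \<le> C" if A: "A \<in> cube_mats n d" "\<forall>P\<in>\<P>. avoids A P" for A n
    proof (rule ccontr)
      assume "\<not> card (ones A) \<le> C"
      then obtain B where B: "B \<in> J_mats m d \<union> D_mats m d" "contains A B"
        using C[OF A(1)] by auto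
      then obtain P where P: "P \<in> \<P>" "contains B P"
        using hit by blast
      have "contains A P"
        using contains_trans[OF B(2) P(2)] cube(1)[OF B(1)] P(1) assms(2)
        by (auto simp: cube_mats_def is_mat_def)
      then show False
        using A(2) P(1) by blast
    qed
    then show "\<exists>C. \<forall>n>0. ex_num n \<P> d \<le> C"
      using ex_num_le by metis
  next
    fix n :: nat
    assume "\<not> (\<exists>n0>0. \<not> (\<exists>A \<in> J_mats n0 d \<union> D_mats n0 d. \<forall>P\<in>\<P>. avoids A P))" "0 < n"
    then obtain A where A: "A \<in> J_mats n d \<union> D_mats n d" "\<forall>P\<in>\<P>. avoids A P"
      by blast
    \<comment> \<open>The avoiding matrix \<open>A\<close> is itself a cube of side \<open>n\<close>
      with exactly \<open>n\<close> ones.\<close>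
    show "ex_num n \<P> d \<ge> n"
      using card_ones_le_ex_num[OF cube(1)[OF A(1)] A(2)] cube(2)[OF A(1)] by simp
  }
qed

end
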